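(* Let $G$ be a connected graph of order $m$ and let $n$ be a positive integer. Then $$N(G\times P_n)\ \ge\ N_L(G\times P_n)\ =\ n\cdot N(G)+\sum_{k=2}^{n}(n-k+1)\cdot\left(\mathbf{1}^{T} A^{k-1}\mathbf{1}\right),$$ where $A=(a_{ij})_{i,j\in\{1,2,\dots,2^m-1\}}$ is defined as follows: fix a bijection $\phi$ from $\{1,2,\dots,2^m-1\}$ to the set of non-empty subsets of $V(G)$, and let $u,v$ be two adjacent vertices of a path; then $a_{ij}=1$ if $\{(p,u):p\in\phi(i)\}\cup\{(q,v):q\in\phi(j)\}$ is a connected set of $G\times P_2$ (equivalently, of $G\times P_n$ when $uv\in E(P_n)$), and $a_{ij}=0$ otherwise. Here $\mathbf{1}$ is the all-ones column vector of length $2^m-1$. Moreover, the equality $N(G\times P_n)=N_L(G\times P_n)$ holds only when $G$ is a complete graph or $n\in\{1,2\}$.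
   Context: All graphs are finite and simple. A connected set of a graph $H$ is a non-empty subset $C\subseteq V(H)$ such that the induced subgraph $H[C]$ is connected; $\mathcal{C}(H)$ denotes the set of all connected sets of $H$ and $N(H)=|\mathcal{C}(H)|$. $P_n$ is the path on $n$ vertices. The Cartesian product $G\times H$ has vertex set $V(G)\times V(H)$, with $(x_1,y_1)(x_2,y_2)$ an edge iff either $x_1x_2\in E(G)$ and $y_1=y_2$, or $y_1y_2\in E(H)$ and $x_1=x_2$. In $G\times P_n$, a column is the set of all vertices with a fixed second coordinate; two columns $X,Y$ are consecutive if their second coordinates are adjacent in $P_n$. $\mathcal{C}_L(G\times P_n)$ is the set of all $C\in\mathcal{C}(G\times P_n)$ such that for any two consecutive columns $X,Y$ with $X\cap C\neq\emptyset$ and $Y\cap C\neq\emptyset$, the set $C\cap(X\cup Y)$ is a connected set of $G\times P_n$. $N_L(G\times P_n)=|\mathcal{C}_L(G\times P_n)|$. *)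

theory Defs
  imports "Graph_Theory.Graph_Theory" "Jordan_Normal_Form.Matrix"
begin

text \<open>
  A finite simple graph is a \<open>pair_graph\<close>: every undirected edge \<open>xy\<close> is represented by the two
  arcs \<open>(x, y)\<close> and \<open>(y, x)\<close>.
\<close>

(* The qualified name avoids the topological "connected"; the graph-theoretic one
   is false for the graph without vertices. *)
definition connected_set :: "'a pair_pre_digraph \<Rightarrow> 'a set \<Rightarrow> bool" where
  "connected_set H C \<longleftrightarrow>
     C \<noteq> {} \<and> C \<subseteq> pverts H \<and> Digraph_Component.connected (with_proj H \<restriction> C)"

definition connected_sets :: "'a pair_pre_digraph \<Rightarrow> 'a set set" where
  "connected_sets H = {C. connected_set H C}"

definition num_connected :: "'a pair_pre_digraph \<Rightarrow> nat" where
  "num_connected H = card (connected_sets H)"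

definition path_graph :: "nat \<Rightarrow> nat pair_pre_digraph" where
  "path_graph n = \<lparr> pverts = {1..n},
     parcs = {(i, j). i \<in> {1..n} \<and> j \<in> {1..n} \<and> (j = Suc i \<or> i = Suc j)} \<rparr>"

definition cartesian_product ::
    "'a pair_pre_digraph \<Rightarrow> 'b pair_pre_digraph \<Rightarrow> ('a \<times> 'b) pair_pre_digraph" where
  "cartesian_product G H = \<lparr> pverts = pverts G \<times> pverts H,
     parcs = {((x1, y1), (x2, y2)).
       {x1, x2} \<subseteq> pverts G \<and> {y1, y2} \<subseteq> pverts H \<and>
       ((x1, x2) \<in> parcs G \<and> y1 = y2 \<or> (y1, y2) \<in> parcs H \<and> x1 = x2)} \<rparr>"

definition column :: "'a pair_pre_digraph \<Rightarrow> nat \<Rightarrow> ('a \<times> nat) set" where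
  "column G j = pverts G \<times> {j}"

definition connected_sets_L :: "'a pair_pre_digraph \<Rightarrow> nat \<Rightarrow> ('a \<times> nat) set set" where
  "connected_sets_L G n =
     {C \<in> connected_sets (cartesian_product G (path_graph n)).
        \<forall>(i, j) \<in> parcs (path_graph n).
          column G i \<inter> C \<noteq> {} \<longrightarrow> column G j \<inter> C \<noteq> {} \<longrightarrow>
          connected_set (cartesian_product G (path_graph n)) (C \<inter> (column G i \<union> column G j))}"

definition num_connected_L :: "'a pair_pre_digraph \<Rightarrow> nat \<Rightarrow> nat" where
  "num_connected_L G n = card (connected_sets_L G n)"

text \<open>
  The 0-1 matrix of a graph \<open>G\<close> of order \<open>m\<close>, an enumeration \<open>\<phi>\<close> of the non-empty vertex sets by
  \<open>1, \<dots>, 2 ^ m - 1\<close>, and two adjacent vertices \<open>u\<close>, \<open>v\<close> of the path on \<open>l\<close> vertices. Matrix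
  indices start at 0, hence the shift by \<open>Suc\<close>.
\<close>

definition layer_matrix ::
    "'a pair_pre_digraph \<Rightarrow> (nat \<Rightarrow> 'a set) \<Rightarrow> nat \<Rightarrow> nat \<Rightarrow> nat \<Rightarrow> nat mat" where
  "layer_matrix G \<phi> l u v =
     (let N = 2 ^ card (pverts G) - 1 in
      mat N N (\<lambda>(i, j).
        if connected_set (cartesian_product G (path_graph l))
             ({(p, u) | p. p \<in> \<phi> (Suc i)} \<union> {(q, v) | q. q \<in> \<phi> (Suc j)})
        then 1 else 0))"

definition ones_vec :: "nat \<Rightarrow> nat vec" where
  "ones_vec N = vec N (\<lambda>_. 1)"

lemma pair_graph_path_graph: "pair_graph (path_graph n)"
proof -
  have "parcs (path_graph n) \<subseteq> {1..n} \<times> {1..n}"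
    by (auto simp: path_graph_def)
  then have "finite (parcs (path_graph n))"
    by (rule finite_subset) simp
  then show ?thesis
    by unfold_locales (auto simp: path_graph_def symmetric_def intro!: symI)
qed

lemma pair_graph_cartesian_product:
  assumes "pair_graph G" "pair_graph H"
  shows "pair_graph (cartesian_product G H)"
proof -
  interpret G: pair_graph G by fact
  interpret H: pair_graph H by fact
  have "parcs (cartesian_product G H) \<subseteq> (pverts G \<times> pverts H) \<times> (pverts G \<times> pverts H)"
    by (auto simp: cartesian_product_def)
  then have "finite (parcs (cartesian_product G H))"
    by (rule finite_subset) simp
  then show ?thesis
    by unfold_locales
      (auto simp: cartesian_product_def symmetric_def intro!: symI
            dest: G.arcs_symmetric H.arcs_symmetric G.no_loops' H.no_loops')
qed

end

theory Submission
  imports Defs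
begin

text \<open>
  The non-empty columns of a connected set \<open>C\<close> of \<open>G \<times> P\<^sub>n\<close> form an interval, so \<open>C\<close> is
  determined by its first column and the list of its layers \<open>S\<^sub>1, \<dots>, S\<^sub>k \<subseteq> V(G)\<close>. Such a
  list comes from a member of \<open>C\<^sub>L\<close> iff any two consecutive layers together are connected, or,
  for \<open>k = 1\<close>, iff \<open>S\<^sub>1\<close> is connected in \<open>G\<close>. There are \<open>n - k + 1\<close> choices of the first
  column, and for \<open>k \<ge> 2\<close> the lists are the walks with \<open>k\<close> vertices in the graph with
  adjacency matrix \<open>A\<close>.
\<close>

section \<open>Connectivity of a vertex set under a relation\<close>

text \<open>\<open>rtrancl_on C r\<close> only visits points of \<open>C\<close>, so this is
  connectivity of the induced subgraph, freed from any graph record. Walks are directed, which makes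
  no difference for the symmetric relations considered here.\<close>

definition arc_connected :: "'a rel \<Rightarrow> 'a set \<Rightarrow> bool" where
  "arc_connected r C \<longleftrightarrow> C \<noteq> {} \<and> (\<forall>x\<in>C. \<forall>y\<in>C. (x, y) \<in> rtrancl_on C r)"

lemma rtrancl_on_image:
  assumes "(x, y) \<in> rtrancl_on C r"
    and "\<And>x y. x \<in> C \<Longrightarrow> y \<in> C \<Longrightarrow> (x, y) \<in> r \<Longrightarrow> (f x, f y) \<in> s"
  shows "(f x, f y) \<in> rtrancl_on (f ` C) s"
  using assms(1)
proof (induction rule: rtrancl_on_induct)
  case base
  then show ?case by auto
next
  case (step y z)
  then show ?case
    using assms(2)[of y z] rtrancl_on_into_rtrancl_on[of "f x" "f y" "f ` C" s "f z"] by blast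
qed

lemma arc_connected_image:
  assumes "arc_connected r C"
    and "\<And>x y. x \<in> C \<Longrightarrow> y \<in> C \<Longrightarrow> (x, y) \<in> r \<Longrightarrow> (f x, f y) \<in> s"
  shows "arc_connected s (f ` C)"
  using assms rtrancl_on_image[of _ _ C r f s] by (auto simp: arc_connected_def)

text \<open>An isomorphism and its inverse both carry walks to walks. This is what allows columns to
  be shifted and reflected.\<close>

lemma arc_connected_image_iff:
  assumes "inj_on f C"
    and "\<And>x y. x \<in> C \<Longrightarrow> y \<in> C \<Longrightarrow> (f x, f y) \<in> s \<longleftrightarrow> (x, y) \<in> r"
  shows "arc_connected s (f ` C) \<longleftrightarrow> arc_connected r C"
proof
  assume "arc_connected s (f ` C)"
  then have "arc_connected r (inv_into C f ` f ` C)"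
    by (rule arc_connected_image) (use assms in \<open>auto simp: inv_into_f_f\<close>)
  then show "arc_connected r C"
    using assms(1) by (simp add: inv_into_image_cancel)
qed (use assms in \<open>auto intro: arc_connected_image\<close>)

lemma arc_connected_cong:
  assumes "\<And>x y. x \<in> C \<Longrightarrow> y \<in> C \<Longrightarrow> (x, y) \<in> s \<longleftrightarrow> (x, y) \<in> r"
  shows "arc_connected s C \<longleftrightarrow> arc_connected r C"
  using arc_connected_image_iff[of "\<lambda>x. x" C s r] assms by simp

text \<open>Every point of the union is joined in both directions to a common point
  \<open>z\<close>.\<close>

lemma arc_connected_Un:
  assumes "arc_connected r A" "arc_connected r B" "A \<inter> B \<noteq> {}"
  shows "arc_connected r (A \<union> B)"
proof -
  obtain z where z: "z \<in> A" "z \<in> B" using assms(3) by blast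
  have "(x, z) \<in> rtrancl_on (A \<union> B) r \<and> (z, x) \<in> rtrancl_on (A \<union> B) r" if "x \<in> A \<union> B" for x
  proof (cases "x \<in> A")
    case True
    then show ?thesis
      using assms(1) z rtrancl_on_mono[of r r A "A \<union> B"] by (auto simp: arc_connected_def)
  next
    case False
    then show ?thesis
      using assms(2) z that rtrancl_on_mono[of r r B "A \<union> B"] by (auto simp: arc_connected_def)
  qed
  then show ?thesis
    using z by (auto simp only: arc_connected_def intro: rtrancl_on_trans[of _ z])
qed

text \<open>A walk from inside \<open>P\<close> to outside \<open>P\<close> must leave
  \<open>P\<close> along some arc. This is the tool for showing that a set is not connected.\<close>

lemma arc_connected_crossing:
  assumes "arc_connected r C" "x \<in> C" "P x" "y \<in> C" "\<not> P y"
  obtains a b where "a \<in> C" "P a" "b \<in> C" "\<not> P b" "(a, b) \<in> r"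
proof -
  have "(x, y) \<in> rtrancl_on C r" using assms by (auto simp: arc_connected_def)
  then have "\<not> P y \<Longrightarrow> \<exists>a b. a \<in> C \<and> P a \<and> b \<in> C \<and> \<not> P b \<and> (a, b) \<in> r"
    by (induction rule: rtrancl_on_induct) (use assms in blast, blast)
  then show ?thesis using assms(5) that by blast
qed

section \<open>Connected sets of a graph and of the grid\<close>

text \<open>The library notion symmetrises the arcs first; the arcs of a \<open>pair_graph\<close>
  are already symmetric, so symmetrising changes nothing on \<open>C\<close>.\<close>

lemma connected_set_iff:
  assumes "pair_graph H"
  shows "connected_set H C \<longleftrightarrow> C \<subseteq> pverts H \<and> arc_connected (parcs H) C"
proof -
  interpret pair_graph H by fact
  let ?r = "parcs (mk_symmetric (with_proj H \<restriction> C))"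
  have "arc_connected ?r C \<longleftrightarrow> arc_connected (parcs H) C"
    by (rule arc_connected_cong) (auto simp: mk_symmetric_def intro: arcs_symmetric)
  moreover have "Digraph_Component.connected (with_proj H \<restriction> C) \<longleftrightarrow> arc_connected ?r C"
    by (simp add: connected_def strongly_connected_def reachable_def arc_connected_def
        arcs_ends_conv mk_symmetric_def)
  ultimately show ?thesis
    by (auto simp: connected_set_def arc_connected_def)
qed

lemma connected_set_pverts:
  assumes "pair_graph G" "Digraph_Component.connected (with_proj G)"
  shows "connected_set G (pverts G)"
proof -
  interpret pair_graph G by fact
  have "pverts G \<noteq> {}"
    using assms(2) by (auto simp: connected_def strongly_connected_def mk_symmetric_def)
  moreover have "with_proj G \<restriction> pverts G = with_proj G"
    by (auto simp: induce_subgraph_def with_proj_def intro: arc_fst_in_verts arc_snd_in_verts)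
  ultimately show ?thesis
    using assms(2) by (simp add: connected_set_def)
qed

text \<open>The arcs of the product with an infinite path: connectedness of a set of vertices of
  \<open>G \<times> P\<^sub>n\<close> does not depend on \<open>n\<close>.\<close>

definition grid_arcs :: "'a pair_pre_digraph \<Rightarrow> ('a \<times> nat) rel" where
  "grid_arcs G = {((x, i), (y, j)). (x, y) \<in> parcs G \<and> i = j \<or> x = y \<and> (j = Suc i \<or> i = Suc j)}"

lemma connected_set_product_path_iff:
  assumes "pair_graph G"
  shows "connected_set (cartesian_product G (path_graph n)) C \<longleftrightarrow>
    C \<subseteq> pverts G \<times> {1..n} \<and> arc_connected (grid_arcs G) C"
proof -
  have "arc_connected (parcs (cartesian_product G (path_graph n))) C \<longleftrightarrow>
      arc_connected (grid_arcs G) C" if "C \<subseteq> pverts G \<times> {1..n}"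
    by (rule arc_connected_cong)
      (use that in \<open>fastforce simp: cartesian_product_def path_graph_def grid_arcs_def\<close>)
  then show ?thesis
    using connected_set_iff[OF pair_graph_cartesian_product[OF assms pair_graph_path_graph]]
    by (auto simp: cartesian_product_def path_graph_def)
qed

lemma arc_connected_grid_layer:
  assumes "pair_graph G"
  shows "arc_connected (grid_arcs G) (S \<times> {i}) \<longleftrightarrow> arc_connected (parcs G) S"
proof -
  have "S \<times> {i} = (\<lambda>p. (p, i)) ` S" by auto
  then show ?thesis
    using arc_connected_image_iff[of "\<lambda>p. (p, i)" S "grid_arcs G" "parcs G"]
    by (auto simp: grid_arcs_def inj_on_def)
qed

text \<open>The relation whose 0-1 matrix is the matrix of the theorem. Columns \<open>0\<close> and
  \<open>1\<close> merely represent an arbitrary pair of adjacent columns.\<close>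

definition layers_linked :: "'a pair_pre_digraph \<Rightarrow> 'a set \<Rightarrow> 'a set \<Rightarrow> bool" where
  "layers_linked G S T \<longleftrightarrow> arc_connected (grid_arcs G) (S \<times> {0} \<union> T \<times> {1})"

lemma arc_connected_grid_two_layers:
  assumes "j = Suc i \<or> i = Suc j"
  shows "arc_connected (grid_arcs G) (S \<times> {i} \<union> T \<times> {j}) \<longleftrightarrow> layers_linked G S T"
proof -
  \<comment> \<open>\<open>f\<close> moves column \<open>0\<close> to \<open>i\<close> and column
    \<open>1\<close> to \<open>j\<close>. It is injective on the two layers since \<open>i\<close>
    and \<open>j\<close> differ, and it preserves arcs even when it reverses the order of the
    columns.\<close>
  define f :: "'a \<times> nat \<Rightarrow> 'a \<times> nat" where "f = (\<lambda>(p, k). (p, if k = 0 then i else j))"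
  let ?C = "S \<times> {0} \<union> T \<times> {1::nat}"
  have "f ` ?C = S \<times> {i} \<union> T \<times> {j}"
    by (force simp: f_def)
  moreover have "inj_on f ?C"
    using assms by (auto simp: f_def inj_on_def)
  moreover have "(f x, f y) \<in> grid_arcs G \<longleftrightarrow> (x, y) \<in> grid_arcs G" if "x \<in> ?C" "y \<in> ?C" for x y
    using that assms by (auto simp: f_def grid_arcs_def)
  ultimately show ?thesis
    using arc_connected_image_iff[of f ?C "grid_arcs G" "grid_arcs G"]
    by (simp add: layers_linked_def)
qed

text \<open>Put \<open>S\<close> in column \<open>1\<close> and \<open>T\<close> in column
  \<open>0\<close>: up to the order of the union this is the set that defines
  \<open>layers_linked G T S\<close>.\<close>

lemma layers_linked_sym: "layers_linked G S T \<longleftrightarrow> layers_linked G T S"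
  using arc_connected_grid_two_layers[of 0 1 G S T]
  by (simp add: layers_linked_def Un_commute)

section \<open>Sets of grid vertices as lists of layers\<close>

definition layers :: "nat \<Rightarrow> 'a set list \<Rightarrow> ('a \<times> nat) set" where
  "layers a xs = {(p, j). a \<le> j \<and> j < a + length xs \<and> p \<in> xs ! (j - a)}"

definition slice :: "('a \<times> nat) set \<Rightarrow> nat \<Rightarrow> 'a set" where
  "slice C j = {p. (p, j) \<in> C}"

lemma slice_layers:
  "slice (layers a xs) j = (if a \<le> j \<and> j < a + length xs then xs ! (j - a) else {})"
  by (auto simp: slice_def layers_def)

lemma slice_eq_empty_iff: "slice C j = {} \<longleftrightarrow> j \<notin> snd ` C"
  by (force simp: slice_def)

lemma snd_layers:
  assumes "{} \<notin> set xs"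
  shows "snd ` layers a xs = {a..<a + length xs}"
proof -
  have "xs ! (j - a) \<noteq> {}" if "a \<le> j" "j < a + length xs" for j
    using assms that nth_mem[of "j - a" xs] by fastforce
  then have "slice (layers a xs) j \<noteq> {} \<longleftrightarrow> j \<in> {a..<a + length xs}" for j
    by (auto simp: slice_layers)
  then show ?thesis
    by (auto simp only: slice_eq_empty_iff)
qed

text \<open>The occupied columns form an interval that fixes the first column and the length; the
  slices then fix the entries. An empty list would leave the first column undetermined.\<close>

lemma layers_inject:
  assumes "layers a xs = layers b ys" "{} \<notin> set xs" "{} \<notin> set ys" "xs \<noteq> []" "ys \<noteq> []"
  shows "a = b \<and> xs = ys"
proof -
  have "{a..<a + length xs} = {b..<b + length ys}"
    using snd_layers assms by metis
  then have ab: "a = b" "length xs = length ys"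
    using assms(4,5) by (auto simp: atLeastLessThan_eq_iff)
  have "xs ! i = ys ! i" if "i < length xs" for i
    using slice_layers[of a xs "a + i"] slice_layers[of b ys "b + i"] ab that assms(1) by simp
  then show ?thesis
    using ab by (simp add: list_eq_iff_nth_eq)
qed

lemma layers_Nil [simp]: "layers a [] = {}"
  by (auto simp: layers_def)

lemma layers_Cons: "layers a (S # xs) = S \<times> {a} \<union> layers (Suc a) xs"
proof -
  have "j = a \<or> Suc a \<le> j \<and> j - a = Suc (j - Suc a)" if "a \<le> j" for j
    using that by auto
  then show ?thesis
    by (fastforce simp: layers_def nth_Cons')
qed

text \<open>Consecutive linked pairs are glued along the layer they share. A single layer belongs to
  no pair, so its connectedness has to be assumed.\<close>

lemma arc_connected_layers:
  assumes "pair_graph G" "xs \<noteq> []" "{} \<notin> set xs" "successively (layers_linked G) xs"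
    and "length xs = 1 \<longrightarrow> arc_connected (parcs G) (hd xs)"
  shows "arc_connected (grid_arcs G) (layers a xs)"
  using assms(2-)
proof (induction xs arbitrary: a rule: induct_list012)
  case (2 S)
  then show ?case
    using arc_connected_grid_layer[OF assms(1)] by (simp add: layers_Cons)
next
  case (3 S T xs)
  have ST: "arc_connected (grid_arcs G) (S \<times> {a} \<union> T \<times> {Suc a})"
    using 3 by (simp add: arc_connected_grid_two_layers)
  show ?case
  proof (cases xs)
    \<comment> \<open>The induction hypothesis is out of reach here: the remaining layer
      \<open>T\<close> need not be connected by itself. The linked pair is already the whole
      set.\<close>
    case Nil
    then show ?thesis using ST by (simp add: layers_Cons)
  next
    case Cons
    then have "arc_connected (grid_arcs G) (layers (Suc a) (T # xs))"
      using 3 by auto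
    moreover have "T \<noteq> {}" using 3 by auto
    moreover have "layers a (S # T # xs) =
        (S \<times> {a} \<union> T \<times> {Suc a}) \<union> layers (Suc a) (T # xs)"
      by (auto simp: layers_Cons)
    ultimately show ?thesis
      using arc_connected_Un[OF ST] by (auto simp: layers_Cons)
  qed
qed simp

section \<open>Layerwise description of \<open>connected_sets_L\<close>\<close>

lemma Int_columns:
  assumes "C \<subseteq> pverts G \<times> A"
  shows "C \<inter> (column G i \<union> column G j) = slice C i \<times> {i} \<union> slice C j \<times> {j}"
  using assms by (auto simp: column_def slice_def)

lemma column_Int_eq_empty_iff:
  assumes "C \<subseteq> pverts G \<times> A"
  shows "column G i \<inter> C = {} \<longleftrightarrow> i \<notin> snd ` C"
  using assms by (force simp: column_def)

text \<open>Connectedness of two adjacent columns depends only on their slices. Path arcs come in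
  both directions, but by symmetry of \<open>layers_linked\<close> the pairs \<open>i\<close>,
  \<open>Suc i\<close> suffice.\<close>

lemma connected_sets_L_iff:
  assumes "pair_graph G"
  shows "C \<in> connected_sets_L G n \<longleftrightarrow>
    C \<subseteq> pverts G \<times> {1..n} \<and> arc_connected (grid_arcs G) C \<and>
    (\<forall>i. i \<in> snd ` C \<longrightarrow> Suc i \<in> snd ` C \<longrightarrow> layers_linked G (slice C i) (slice C (Suc i)))"
    (is "_ \<longleftrightarrow> ?sub \<and> ?conn \<and> ?linked")
proof (cases "?sub \<and> ?conn")
  case True
  let ?Q = "\<lambda>i j. i \<in> snd ` C \<longrightarrow> j \<in> snd ` C \<longrightarrow> layers_linked G (slice C i) (slice C j)"
  let ?X = "\<lambda>i j. column G i \<inter> C \<noteq> {} \<longrightarrow> column G j \<inter> C \<noteq> {} \<longrightarrow>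
      connected_set (cartesian_product G (path_graph n)) (C \<inter> (column G i \<union> column G j))"
  have iff: "?X i j \<longleftrightarrow> ?Q i j" if "(i, j) \<in> parcs (path_graph n)" for i j
    using that True Int_columns[of C G "{1..n}" i j] column_Int_eq_empty_iff[of C G "{1..n}"]
      connected_set_product_path_iff[OF assms, of n "C \<inter> (column G i \<union> column G j)"]
      arc_connected_grid_two_layers[of j i G "slice C i" "slice C j"]
    by (auto simp: path_graph_def)
  have "C \<in> connected_sets_L G n \<longleftrightarrow> (\<forall>i j. (i, j) \<in> parcs (path_graph n) \<longrightarrow> ?X i j)"
    using True connected_set_product_path_iff[OF assms, of n C]
    by (simp add: connected_sets_L_def connected_sets_def Ball_def)
  also have "\<dots> \<longleftrightarrow> (\<forall>i j. (i, j) \<in> parcs (path_graph n) \<longrightarrow> ?Q i j)"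
    by (intro iff_allI imp_cong refl iff)
  also have "\<dots> \<longleftrightarrow> ?linked"
  proof
    assume *: "\<forall>i j. (i, j) \<in> parcs (path_graph n) \<longrightarrow> ?Q i j"
    have "(i, Suc i) \<in> parcs (path_graph n)" if "i \<in> snd ` C" "Suc i \<in> snd ` C" for i
      using that True by (auto simp: path_graph_def)
    then show ?linked using * by blast
  next
    assume linked: ?linked
    show "\<forall>i j. (i, j) \<in> parcs (path_graph n) \<longrightarrow> ?Q i j"
    proof (intro allI impI)
      fix i j assume "(i, j) \<in> parcs (path_graph n)" and ij: "i \<in> snd ` C" "j \<in> snd ` C"
      then consider "j = Suc i" | "i = Suc j" by (auto simp: path_graph_def)
      then show "layers_linked G (slice C i) (slice C j)"
        using linked ij layers_linked_sym[of G "slice C i" "slice C j"] by cases simp_all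
    qed
  qed
  finally show ?thesis using True by blast
next
  case False
  then have "C \<notin> connected_sets (cartesian_product G (path_graph n))"
    using connected_set_product_path_iff[OF assms, of n C] by (simp add: connected_sets_def)
  then show ?thesis
    unfolding connected_sets_L_def using False by blast
qed

text \<open>An arc changes the column by at most one. If column \<open>j\<close> between the
  extremes were empty, an arc leaving the columns below \<open>j\<close> would have to end in column
  \<open>j\<close>.\<close>

lemma snd_arc_connected_grid:
  assumes "arc_connected (grid_arcs G) C" "finite (snd ` C)"
  shows "snd ` C = {Min (snd ` C)..Max (snd ` C)}"
proof -
  let ?J = "snd ` C"
  have "?J \<noteq> {}" using assms(1) by (simp add: arc_connected_def)
  then have minmax: "Min ?J \<in> ?J" "Max ?J \<in> ?J"
    using assms(2) by auto
  have "j \<in> ?J" if j: "Min ?J \<le> j" "j \<le> Max ?J" for j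
  proof (rule ccontr)
    assume "j \<notin> ?J"
    then have *: "Min ?J < j" "j < Max ?J"
      using minmax j by (metis le_neq_implies_less)+
    obtain x y where xy: "x \<in> C" "snd x = Min ?J" "y \<in> C" "snd y = Max ?J"
      using minmax by (metis imageE)
    then have "snd x < j" "\<not> snd y < j" using * by auto
    then obtain s t where st: "s \<in> C" "snd s < j" "t \<in> C" "\<not> snd t < j" "(s, t) \<in> grid_arcs G"
      using arc_connected_crossing[OF assms(1) xy(1), of "\<lambda>z. snd z < j" y] xy(3) by blast
    have "snd t \<noteq> j" using \<open>j \<notin> ?J\<close> st by blast
    then show False
      using st by (auto simp: grid_arcs_def)
  qed
  then have "{Min ?J..Max ?J} \<subseteq> ?J"
    by (intro subsetI) (simp only: atLeastAtMost_iff)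
  moreover have "?J \<subseteq> {Min ?J..Max ?J}"
    using Min_le[OF assms(2)] Max_ge[OF assms(2)] by (intro subsetI) (simp only: atLeastAtMost_iff)
  ultimately show ?thesis by (rule equalityI[rotated])
qed

section \<open>Counting by first column and list of layers\<close>

definition linked_chains :: "'a pair_pre_digraph \<Rightarrow> nat \<Rightarrow> 'a set list set" where
  "linked_chains G k =
    {xs. length xs = k \<and> set xs \<subseteq> Pow (pverts G) - {{}} \<and> successively (layers_linked G) xs}"

text \<open>For \<open>k = 1\<close> linking is vacuous and connectedness in \<open>G\<close> is
  imposed instead; this is why the formula starts with \<open>N(G)\<close> and not with the number
  of all non-empty vertex sets.\<close>

definition layer_lists :: "'a pair_pre_digraph \<Rightarrow> nat \<Rightarrow> 'a set list set" where
  "layer_lists G k =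
    {xs \<in> linked_chains G k. k = 1 \<longrightarrow> arc_connected (parcs G) (hd xs)}"

lemma finite_linked_chains:
  assumes "finite (pverts G)"
  shows "finite (linked_chains G k)"
proof (rule finite_subset)
  show "linked_chains G k \<subseteq> {xs. set xs \<subseteq> Pow (pverts G) \<and> length xs = k}"
    by (auto simp: linked_chains_def)
qed (use assms in \<open>simp add: finite_lists_length_eq\<close>)

text \<open>The bound on \<open>a + k\<close> says that the last occupied column
  \<open>a + k - 1\<close> is at most \<open>n\<close>.\<close>

lemma layers_in_connected_sets_L:
  assumes "pair_graph G" "xs \<in> layer_lists G k" "1 \<le> k" "1 \<le> a" "a + k \<le> Suc n"
  shows "layers a xs \<in> connected_sets_L G n"
proof -
  have xs: "length xs = k" "set xs \<subseteq> Pow (pverts G) - {{}}" "successively (layers_linked G) xs"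
    "k = 1 \<longrightarrow> arc_connected (parcs G) (hd xs)"
    using assms(2) by (auto simp: layer_lists_def linked_chains_def)
  have "layers a xs \<subseteq> pverts G \<times> {1..n}"
  proof
    fix z assume "z \<in> layers a xs"
    then obtain p j where z: "z = (p, j)" "a \<le> j" "j < a + length xs" "p \<in> xs ! (j - a)"
      by (auto simp: layers_def)
    then have "xs ! (j - a) \<in> set xs" by (intro nth_mem) auto
    then have "xs ! (j - a) \<subseteq> pverts G" using xs(2) by blast
    then show "z \<in> pverts G \<times> {1..n}"
      using xs z assms by auto
  qed
  moreover have "arc_connected (grid_arcs G) (layers a xs)"
    by (rule arc_connected_layers) (use assms xs in auto)
  moreover have "layers_linked G (slice (layers a xs) i) (slice (layers a xs) (Suc i))"
    if "i \<in> snd ` layers a xs" "Suc i \<in> snd ` layers a xs" for i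
  proof -
    have "snd ` layers a xs = {a..<a + k}"
      using snd_layers xs by blast
    then have i: "a \<le> i" "Suc i < a + k" using that by auto
    then have "Suc (i - a) < length xs" "Suc i - a = Suc (i - a)" using xs(1) by auto
    then show ?thesis
      using xs(3) i xs(1) by (simp add: slice_layers successively_conv_nth)
  qed
  ultimately show ?thesis
    using connected_sets_L_iff[OF assms(1)] by blast
qed

text \<open>The occupied columns form an interval by \<open>snd_arc_connected_grid\<close>; the list
  consists of the slices over it.\<close>

lemma connected_sets_L_obtain_layers:
  assumes "pair_graph G" "C \<in> connected_sets_L G n"
  obtains a k xs where "xs \<in> layer_lists G k" "1 \<le> k" "1 \<le> a" "a + k \<le> Suc n" "C = layers a xs"
proof -
  have C: "C \<subseteq> pverts G \<times> {1..n}" "arc_connected (grid_arcs G) C"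
    and linked: "\<And>i. i \<in> snd ` C \<Longrightarrow> Suc i \<in> snd ` C \<Longrightarrow>
      layers_linked G (slice C i) (slice C (Suc i))"
    using assms connected_sets_L_iff by blast+
  have sub: "snd ` C \<subseteq> {1..n}" and ne: "C \<noteq> {}"
    using C by (auto simp: arc_connected_def)
  define a b where "a = Min (snd ` C)" and "b = Max (snd ` C)"
  have J: "snd ` C = {a..b}"
    unfolding a_def b_def
    by (rule snd_arc_connected_grid) (use C sub finite_subset in blast)+
  have ab: "1 \<le> a" "a \<le> b" "b \<le> n"
    using J ne sub by (auto simp: image_subset_iff)
  define xs where "xs = map (slice C) [a..<Suc b]"
  have len: "length xs = Suc b - a" by (simp add: xs_def del: upt_Suc)
  have nth: "xs ! i = slice C (a + i)" if "i < Suc b - a" for i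
    using that by (simp add: xs_def nth_map nth_upt del: upt_Suc)
  have C_eq: "C = layers a xs"
  proof -
    have "slice (layers a xs) j = slice C j" for j
      using J len nth[of "j - a"] slice_eq_empty_iff[of C j] by (auto simp: slice_layers)
    then show ?thesis by (auto simp: slice_def)
  qed
  have "set xs \<subseteq> Pow (pverts G) - {{}}"
    using J C(1) slice_eq_empty_iff[of C] by (auto simp: xs_def slice_def simp del: upt_Suc)
  moreover have "successively (layers_linked G) xs"
    using linked J nth len by (auto simp: successively_conv_nth)
  moreover have "arc_connected (parcs G) (hd xs)" if "length xs = 1"
  proof -
    have "C = hd xs \<times> {a}"
      using that C_eq by (auto simp: length_Suc_conv layers_Cons)
    then show ?thesis
      using C(2) arc_connected_grid_layer[OF assms(1)] by metis
  qed
  ultimately have "xs \<in> layer_lists G (length xs)"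
    by (auto simp: layer_lists_def linked_chains_def)
  then show ?thesis
    using that[of xs "length xs" a] len ab C_eq by auto
qed

lemma card_connected_sets_L:
  assumes "pair_graph G"
  shows "card (connected_sets_L G n) = (\<Sum>k = 1..n. (n - k + 1) * card (layer_lists G k))"
proof -
  interpret pair_graph G by fact
  \<comment> \<open>A length \<open>k\<close>, a first column \<open>a\<close> and a list of layers;
    \<open>a\<close> has \<open>n - k + 1\<close> possible values.\<close>
  let ?I = "SIGMA k:{1..n}. {1..Suc n - k} \<times> layer_lists G k"
  let ?f = "\<lambda>(k::nat, a, xs). layers a xs"
  have fin: "finite (layer_lists G k)" for k
    by (rule finite_subset[OF _ finite_linked_chains[of G k]]) (auto simp: layer_lists_def)
  have props: "xs \<noteq> [] \<and> length xs = k \<and> {} \<notin> set xs" if "xs \<in> layer_lists G k" "1 \<le> k" for xs k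
    using that by (auto simp: layer_lists_def linked_chains_def)
  have inj: "inj_on ?f ?I"
  proof (rule inj_onI)
    fix x y assume xy: "x \<in> ?I" "y \<in> ?I" "?f x = ?f y"
    obtain k a xs l b ys where [simp]: "x = (k, a, xs)" "y = (l, b, ys)"
      by (metis prod.exhaust)
    show "x = y"
      using xy props[of xs k] props[of ys l] layers_inject[of a xs b ys] by auto
  qed
  have image: "?f ` ?I = connected_sets_L G n"
  proof (intro equalityI subsetI)
    fix C assume "C \<in> ?f ` ?I"
    then show "C \<in> connected_sets_L G n"
      using layers_in_connected_sets_L[OF assms] by fastforce
  next
    fix C assume "C \<in> connected_sets_L G n"
    then obtain a k xs where *: "xs \<in> layer_lists G k" "1 \<le> k" "1 \<le> a" "a + k \<le> Suc n"
      "C = layers a xs"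
      using connected_sets_L_obtain_layers[OF assms] by blast
    then have "(k, a, xs) \<in> ?I" by auto
    then show "C \<in> ?f ` ?I" using * by force
  qed
  have "card (connected_sets_L G n) = card ?I"
    using card_image[OF inj] by (simp only: image)
  also have "\<dots> = (\<Sum>k = 1..n. card ({1..Suc n - k} \<times> layer_lists G k))"
    by (rule card_SigmaI) (use fin in auto)
  also have "\<dots> = (\<Sum>k = 1..n. (n - k + 1) * card (layer_lists G k))"
    by (rule sum.cong) (auto simp: card_cartesian_product Suc_diff_le)
  finally show ?thesis .
qed

lemma card_layer_lists_1:
  assumes "pair_graph G"
  shows "card (layer_lists G 1) = num_connected G"
proof -
  have "layer_lists G 1 = (\<lambda>S. [S]) ` connected_sets G"
    using connected_set_iff[OF assms]
    by (auto simp: layer_lists_def linked_chains_def connected_sets_def length_Suc_conv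
        arc_connected_def)
  then show ?thesis
    by (simp add: num_connected_def card_image inj_on_def)
qed

section \<open>Powers of the layer matrix count chains\<close>

text \<open>This will be the entry at \<open>S\<close> of the \<open>k\<close>-th matrix power
  applied to the all-ones vector: \<open>k\<close> counts steps, so the chains have
  \<open>Suc k\<close> layers.\<close>

definition num_chains_from :: "'a pair_pre_digraph \<Rightarrow> nat \<Rightarrow> 'a set \<Rightarrow> nat" where
  "num_chains_from G k S = card {xs \<in> linked_chains G (Suc k). hd xs = S}"

lemma num_chains_from_0:
  assumes "S \<in> Pow (pverts G) - {{}}"
  shows "num_chains_from G 0 S = 1"
proof -
  have "{xs \<in> linked_chains G (Suc 0). hd xs = S} = {[S]}"
    using assms by (auto simp: linked_chains_def length_Suc_conv)
  then show ?thesis by (simp add: num_chains_from_def)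
qed

text \<open>Removing the first layer \<open>S\<close> leaves a chain whose head \<open>T\<close> is
  linked to \<open>S\<close>; chains with different heads are distinct. The sum is one row of a
  matrix-vector product.\<close>

lemma num_chains_from_Suc:
  assumes "finite (pverts G)" "S \<in> Pow (pverts G) - {{}}"
  shows "num_chains_from G (Suc k) S =
    (\<Sum>T \<in> Pow (pverts G) - {{}}. (if layers_linked G S T then 1 else 0) * num_chains_from G k T)"
proof -
  let ?P = "Pow (pverts G) - {{}}"
  let ?F = "\<lambda>T. {xs \<in> linked_chains G (Suc k). hd xs = T}"
  let ?T = "{T \<in> ?P. layers_linked G S T}"
  have "{xs \<in> linked_chains G (Suc (Suc k)). hd xs = S} = (#) S ` (\<Union>T\<in>?T. ?F T)"
  proof (intro equalityI subsetI)
    fix xs assume xs: "xs \<in> {xs \<in> linked_chains G (Suc (Suc k)). hd xs = S}"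
    then obtain T ys where "xs = S # T # ys"
      by (auto simp: linked_chains_def length_Suc_conv)
    then show "xs \<in> (#) S ` (\<Union>T\<in>?T. ?F T)"
      using xs by (auto simp: linked_chains_def)
  next
    fix xs assume "xs \<in> (#) S ` (\<Union>T\<in>?T. ?F T)"
    then obtain ys where "xs = S # ys" "ys \<in> linked_chains G (Suc k)" "layers_linked G S (hd ys)"
      by blast
    then show "xs \<in> {xs \<in> linked_chains G (Suc (Suc k)). hd xs = S}"
      using assms(2) by (cases ys) (auto simp: linked_chains_def)
  qed
  then have "num_chains_from G (Suc k) S = card (\<Union>T\<in>?T. ?F T)"
    by (simp add: num_chains_from_def card_image)
  also have "\<dots> = (\<Sum>T\<in>?T. card (?F T))"
    by (rule card_UN_disjoint) (use assms(1) finite_linked_chains[OF assms(1)] in auto)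
  also have "\<dots> = (\<Sum>T\<in>?P. if layers_linked G S T then card (?F T) else 0)"
    by (rule sum.inter_filter) (use assms(1) in auto)
  finally show ?thesis
    by (simp add: num_chains_from_def if_distrib[of "\<lambda>c. c * _"] cong: if_cong)
qed

lemma card_linked_chains_Suc:
  assumes "finite (pverts G)"
  shows "card (linked_chains G (Suc k)) = (\<Sum>S \<in> Pow (pverts G) - {{}}. num_chains_from G k S)"
proof -
  let ?F = "\<lambda>S. {xs \<in> linked_chains G (Suc k). hd xs = S}"
  have "linked_chains G (Suc k) = (\<Union>S \<in> Pow (pverts G) - {{}}. ?F S)"
    by (auto simp: linked_chains_def length_Suc_conv)
  then have "card (linked_chains G (Suc k)) = card (\<Union>S \<in> Pow (pverts G) - {{}}. ?F S)"
    by simp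
  also have "\<dots> = (\<Sum>S \<in> Pow (pverts G) - {{}}. card (?F S))"
    by (rule card_UN_disjoint) (use assms finite_linked_chains[OF assms] in auto)
  finally show ?thesis by (simp add: num_chains_from_def)
qed

text \<open>\<open>pow_mat\<close> multiplies the new factor on the right, whereas the recursion on
  the first layer needs it on the left.\<close>

lemma pow_mat_Suc_mult_vec:
  assumes "A \<in> carrier_mat N N" "v \<in> carrier_vec N"
  shows "A ^\<^sub>m Suc k *\<^sub>v v = A *\<^sub>v (A ^\<^sub>m k *\<^sub>v v)"
  using assms(2)
proof (induction k arbitrary: v)
  case 0
  then show ?case using assms(1) by simp
next
  case (Suc k)
  have pow: "A ^\<^sub>m j \<in> carrier_mat N N" for j using assms(1) by simp
  have Av: "A *\<^sub>v v \<in> carrier_vec N" using assms(1) Suc.prems by simp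
  have "A ^\<^sub>m Suc (Suc k) *\<^sub>v v = A ^\<^sub>m Suc k *\<^sub>v (A *\<^sub>v v)"
    using assoc_mult_mat_vec[OF pow[of "Suc k"] assms(1) Suc.prems] by (simp only: pow_mat.simps)
  also have "\<dots> = A *\<^sub>v (A ^\<^sub>m k *\<^sub>v (A *\<^sub>v v))"
    by (rule Suc.IH[OF Av])
  also have "A ^\<^sub>m k *\<^sub>v (A *\<^sub>v v) = A ^\<^sub>m Suc k *\<^sub>v v"
    using assoc_mult_mat_vec[OF pow[of k] assms(1) Suc.prems] by (simp only: pow_mat.simps)
  finally show ?case .
qed

text \<open>The choice of \<open>l\<close>, \<open>u\<close> and \<open>v\<close> disappears,
  because linking does not depend on which adjacent columns are used.\<close>

lemma layer_matrix_eq: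
  assumes "pair_graph G" "(u, v) \<in> parcs (path_graph l)" "card (pverts G) = m"
    and "bij_betw \<phi> {1..2 ^ m - 1} (Pow (pverts G) - {{}})"
  shows "layer_matrix G \<phi> l u v = mat (2 ^ m - 1) (2 ^ m - 1)
    (\<lambda>(i, j). if layers_linked G (\<phi> (Suc i)) (\<phi> (Suc j)) then 1 else 0)"
proof -
  have uv: "u \<in> {1..l}" "v \<in> {1..l}" "v = Suc u \<or> u = Suc v"
    using assms(2) by (auto simp: path_graph_def)
  have "connected_set (cartesian_product G (path_graph l))
      ({(p, u) | p. p \<in> \<phi> (Suc i)} \<union> {(q, v) | q. q \<in> \<phi> (Suc j)})
      \<longleftrightarrow> layers_linked G (\<phi> (Suc i)) (\<phi> (Suc j))" if "i < 2 ^ m - 1" "j < 2 ^ m - 1" for i j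
  proof -
    let ?C = "\<phi> (Suc i) \<times> {u} \<union> \<phi> (Suc j) \<times> {v}"
    have "Suc i \<in> {1..2 ^ m - 1}" "Suc j \<in> {1..2 ^ m - 1}" using that by auto
    then have "\<phi> (Suc i) \<subseteq> pverts G" "\<phi> (Suc j) \<subseteq> pverts G"
      using bij_betwE[OF assms(4)] by blast+
    then have "?C \<subseteq> pverts G \<times> {1..l}"
      using uv(1,2) by blast
    moreover have "{(p, u) | p. p \<in> \<phi> (Suc i)} \<union> {(q, v) | q. q \<in> \<phi> (Suc j)} = ?C"
      by blast
    ultimately show ?thesis
      using arc_connected_grid_two_layers[OF uv(3)] connected_set_product_path_iff[OF assms(1)]
      by metis
  qed
  then show ?thesis
    unfolding layer_matrix_def Let_def assms(3) by (intro cong_mat refl) (simp only: prod.case)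
qed

lemma sum_pow_layer_matrix:
  assumes "pair_graph G" "(u, v) \<in> parcs (path_graph l)" "card (pverts G) = m"
    and "bij_betw \<phi> {1..2 ^ m - 1} (Pow (pverts G) - {{}})"
  shows "ones_vec (2 ^ m - 1) \<bullet> (layer_matrix G \<phi> l u v ^\<^sub>m k *\<^sub>v ones_vec (2 ^ m - 1)) =
    card (linked_chains G (Suc k))"
proof -
  interpret pair_graph G by fact
  define N :: nat where "N = 2 ^ m - 1"
  let ?P = "Pow (pverts G) - {{}}"
  let ?A = "layer_matrix G \<phi> l u v"
  have A: "?A = mat N N (\<lambda>(i, j). if layers_linked G (\<phi> (Suc i)) (\<phi> (Suc j)) then 1 else 0)"
    using layer_matrix_eq[OF assms] by (simp add: N_def)
  then have A_carrier: "?A \<in> carrier_mat N N" by simp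
  \<comment> \<open>Matrix indices start at \<open>0\<close> and the enumeration at
    \<open>1\<close>; after this shift, sums over indices become sums over non-empty vertex
    sets.\<close>
  have "bij_betw Suc {0..<N} {1..N}"
    by (rule bij_betwI[of _ _ _ "\<lambda>i. i - 1"]) auto
  then have bij: "bij_betw (\<lambda>i. \<phi> (Suc i)) {0..<N} ?P"
    using bij_betw_trans[of Suc "{0..<N}" "{1..N}" \<phi> ?P] assms(4) by (simp add: N_def comp_def)
  have reindex: "(\<Sum>i\<in>{0..<N}. g (\<phi> (Suc i))) = (\<Sum>S\<in>?P. g S)" for g :: "'a set \<Rightarrow> nat"
    by (rule sum.reindex_bij_betw[OF bij])
  \<comment> \<open>Entry \<open>i\<close> counts the chains starting with
    \<open>\<phi> (Suc i)\<close>; summing all entries then counts all chains.\<close>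
  have "?A ^\<^sub>m k *\<^sub>v ones_vec N = vec N (\<lambda>i. num_chains_from G k (\<phi> (Suc i)))"
  proof (induction k)
    case 0
    have "?A ^\<^sub>m 0 *\<^sub>v ones_vec N = ones_vec N"
      using A_carrier by (simp add: ones_vec_def)
    also have "\<dots> = vec N (\<lambda>i. num_chains_from G 0 (\<phi> (Suc i)))"
    proof (rule eq_vecI)
      fix i assume "i < dim_vec (vec N (\<lambda>i. num_chains_from G 0 (\<phi> (Suc i))))"
      then have i: "i < N" by simp
      then have "\<phi> (Suc i) \<in> ?P" using bij_betwE[OF bij] by simp
      from num_chains_from_0[OF this] show "ones_vec N $ i = vec N (\<lambda>i. num_chains_from G 0 (\<phi> (Suc i))) $ i"
        using i by (simp add: ones_vec_def)
    qed (simp add: ones_vec_def)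
    finally show ?case .
  next
    case (Suc k)
    have "?A ^\<^sub>m Suc k *\<^sub>v ones_vec N = ?A *\<^sub>v vec N (\<lambda>i. num_chains_from G k (\<phi> (Suc i)))"
      using pow_mat_Suc_mult_vec[OF A_carrier, of "ones_vec N" k] Suc by (simp add: ones_vec_def)
    also have "\<dots> = vec N (\<lambda>i. num_chains_from G (Suc k) (\<phi> (Suc i)))"
    proof (rule eq_vecI)
      fix i assume "i < dim_vec (vec N (\<lambda>i. num_chains_from G (Suc k) (\<phi> (Suc i))))"
      then have i: "i < N" by simp
      then have "\<phi> (Suc i) \<in> ?P" using bij_betwE[OF bij] by simp
      then have "num_chains_from G (Suc k) (\<phi> (Suc i)) = (\<Sum>j\<in>{0..<N}.
          (if layers_linked G (\<phi> (Suc i)) (\<phi> (Suc j)) then 1 else 0) *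
            num_chains_from G k (\<phi> (Suc j)))"
        using num_chains_from_Suc[OF finite_verts, of "\<phi> (Suc i)" k]
          reindex[of "\<lambda>T. (if layers_linked G (\<phi> (Suc i)) T then 1 else 0) * num_chains_from G k T"]
        by (simp only:)
      then show "(?A *\<^sub>v vec N (\<lambda>i. num_chains_from G k (\<phi> (Suc i)))) $ i =
          vec N (\<lambda>i. num_chains_from G (Suc k) (\<phi> (Suc i))) $ i"
        using i by (simp add: A scalar_prod_def)
    qed (use A in simp)
    finally show ?case .
  qed
  then have "ones_vec N \<bullet> (?A ^\<^sub>m k *\<^sub>v ones_vec N) =
      (\<Sum>i\<in>{0..<N}. num_chains_from G k (\<phi> (Suc i)))"
    by (simp add: scalar_prod_def ones_vec_def)
  also have "\<dots> = card (linked_chains G (Suc k))"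
    using reindex[of "num_chains_from G k"] card_linked_chains_Suc[OF finite_verts, of k]
    by (simp only:)
  finally show ?thesis by (simp add: N_def)
qed

section \<open>Comparison with all connected sets\<close>

lemma connected_sets_L_subset:
  "connected_sets_L G n \<subseteq> connected_sets (cartesian_product G (path_graph n))"
  by (auto simp: connected_sets_L_def)

lemma finite_connected_sets:
  assumes "finite (pverts H)"
  shows "finite (connected_sets H)"
  by (rule finite_subset[of _ "Pow (pverts H)"])
    (use assms in \<open>auto simp: connected_sets_def connected_set_def\<close>)

text \<open>For non-adjacent \<open>a \<noteq> b\<close> the set \<open>V(G) \<times> {1} \<union> {a, b} \<times> {2, 3}\<close> is
  connected through its first column, but its last two columns do not form a connected set.\<close>

lemma connected_sets_L_psubset:
  assumes "pair_graph G" "Digraph_Component.connected (with_proj G)"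
    and "a \<in> pverts G" "b \<in> pverts G" "a \<noteq> b" "(a, b) \<notin> parcs G" "3 \<le> n"
  shows "connected_sets_L G n \<noteq> connected_sets (cartesian_product G (path_graph n))"
proof -
  interpret pair_graph G by fact
  \<comment> \<open>A leg over \<open>x\<close> occupies columns 1 to 3 and meets the full first
    column in \<open>(x, 1)\<close>, so adding both legs keeps the set connected.\<close>
  define leg where "leg x = layers 1 [{x}, {x}, {x}]" for x :: 'a
  define C where "C = pverts G \<times> {1} \<union> leg a \<union> leg b"
  have leg: "leg x = {(x, 1), (x, 2), (x, 3)}" for x
    by (auto simp: leg_def layers_Cons)
  have conn_leg: "arc_connected (grid_arcs G) (leg x)" for x
    unfolding leg_def
  proof (rule arc_connected_layers[OF assms(1)])
    have "layers_linked G {x} {x}"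
      unfolding layers_linked_def arc_connected_def
      by (auto intro!: rtrancl_on_into_rtrancl_on[OF rtrancl_on_refl] simp: grid_arcs_def)
    then show "successively (layers_linked G) [{x}, {x}, {x}]" by simp
  qed auto
  have "arc_connected (grid_arcs G) (pverts G \<times> {1})"
    using connected_set_pverts[OF assms(1,2)] arc_connected_grid_layer[OF assms(1)]
      connected_set_iff[OF assms(1)] by blast
  then have "arc_connected (grid_arcs G) C"
    unfolding C_def
    by (intro arc_connected_Un conn_leg) (use assms(3,4) in \<open>auto simp: leg\<close>)
  moreover have "C \<subseteq> pverts G \<times> {1..n}"
    using assms by (auto simp: C_def leg)
  ultimately have "C \<in> connected_sets (cartesian_product G (path_graph n))"
    using connected_set_product_path_iff[OF assms(1)] by (simp add: connected_sets_def)
  moreover have "C \<notin> connected_sets_L G n"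
  proof
    assume "C \<in> connected_sets_L G n"
    moreover have "2 \<in> snd ` C" "Suc 2 \<in> snd ` C" by (force simp: C_def leg)+
    ultimately have "layers_linked G (slice C 2) (slice C (Suc 2))"
      using connected_sets_L_iff[OF assms(1)] by blast
    moreover have "slice C 2 = {a, b}" "slice C (Suc 2) = {a, b}"
      by (auto simp: slice_def C_def leg)
    ultimately have *: "arc_connected (grid_arcs G) ({a, b} \<times> {0} \<union> {a, b} \<times> {1})"
      by (simp only: layers_linked_def)
    let ?D = "{a, b} \<times> {0} \<union> {a, b} \<times> {1::nat}"
    have ab: "(a, 0) \<in> ?D" "(b, 0) \<in> ?D" "fst (a, 0::nat) = a" "fst (b, 0::nat) \<noteq> a"
      using assms(5) by auto
    \<comment> \<open>An arc from the \<open>a\<close> side to the \<open>b\<close> side would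
      either stay in its column, making \<open>a\<close> and \<open>b\<close> adjacent, or change
      column, forcing \<open>a = b\<close>.\<close>
    obtain s t where st: "s \<in> ?D" "fst s = a" "t \<in> ?D" "fst t \<noteq> a" "(s, t) \<in> grid_arcs G"
      by (rule arc_connected_crossing[where P = "\<lambda>z. fst z = a", OF * ab(1) ab(3) ab(2) ab(4)])
    then have "fst t = b" by auto
    then show False
      using st assms(5,6) by (auto simp: grid_arcs_def)
  qed
  ultimately show ?thesis by blast
qed

theorem theorem1p1:
  fixes G :: "'a pair_pre_digraph" and m n l u v :: nat and \<phi> :: "nat \<Rightarrow> 'a set"
  assumes "pair_graph G" and "Digraph_Component.connected (with_proj G)"
    and "card (pverts G) = m" and "n \<ge> 1"
    and "bij_betw \<phi> {1..2 ^ m - 1} {S. S \<noteq> {} \<and> S \<subseteq> pverts G}"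
    and "(u, v) \<in> parcs (path_graph l)"
  defines "A \<equiv> layer_matrix G \<phi> l u v"
  shows "num_connected (cartesian_product G (path_graph n)) \<ge> num_connected_L G n
    \<and> num_connected_L G n =
        n * num_connected G
        + (\<Sum>k = 2..n. (n - k + 1) *
            (ones_vec (2 ^ m - 1) \<bullet> (A ^\<^sub>m (k - 1) *\<^sub>v ones_vec (2 ^ m - 1))))
    \<and> (num_connected (cartesian_product G (path_graph n)) = num_connected_L G n
        \<longrightarrow> complete_digraph m (with_proj G) \<or> n \<in> {1, 2})"
proof (intro conjI impI)
  interpret pair_graph G by fact
  let ?H = "cartesian_product G (path_graph n)"
  have fin: "finite (connected_sets ?H)"
    by (rule finite_connected_sets) (simp add: cartesian_product_def path_graph_def)
  show "num_connected_L G n \<le> num_connected ?H"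
    unfolding num_connected_L_def num_connected_def
    by (rule card_mono[OF fin connected_sets_L_subset])
  have "{S. S \<noteq> {} \<and> S \<subseteq> pverts G} = Pow (pverts G) - {{}}" by auto
  then have bij: "bij_betw \<phi> {1..2 ^ m - 1} (Pow (pverts G) - {{}})"
    using assms(5) by simp
  have chains: "card (layer_lists G k) =
      ones_vec (2 ^ m - 1) \<bullet> (A ^\<^sub>m (k - 1) *\<^sub>v ones_vec (2 ^ m - 1))" if "2 \<le> k" for k
  proof -
    \<comment> \<open>For \<open>k \<ge> 2\<close> the extra condition on single layers is vacuous,
      and \<open>k\<close> layers make \<open>k - 1\<close> steps.\<close>
    have "layer_lists G k = linked_chains G (Suc (k - 1))"
      using that by (auto simp: layer_lists_def)
    then show ?thesis
      using sum_pow_layer_matrix[OF assms(1,6,3) bij] by (simp add: A_def)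
  qed
  have "num_connected_L G n = (\<Sum>k = 1..n. (n - k + 1) * card (layer_lists G k))"
    unfolding num_connected_L_def by (rule card_connected_sets_L[OF assms(1)])
  \<comment> \<open>The term \<open>k = 1\<close> is split off; its coefficient
    \<open>n - 1 + 1\<close> is \<open>n\<close> because \<open>n \<ge> 1\<close>.\<close>
  also have "\<dots> = n * card (layer_lists G 1)
      + (\<Sum>k = Suc 1..n. (n - k + 1) * card (layer_lists G k))"
    using assms(4) by (subst sum.atLeast_Suc_atMost) auto
  also have "(\<Sum>k = Suc 1..n. (n - k + 1) * card (layer_lists G k)) =
      (\<Sum>k = 2..n. (n - k + 1) *
        (ones_vec (2 ^ m - 1) \<bullet> (A ^\<^sub>m (k - 1) *\<^sub>v ones_vec (2 ^ m - 1))))"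
    by (rule sum.cong) (auto simp: chains)
  finally show "num_connected_L G n = n * num_connected G
      + (\<Sum>k = 2..n. (n - k + 1) *
          (ones_vec (2 ^ m - 1) \<bullet> (A ^\<^sub>m (k - 1) *\<^sub>v ones_vec (2 ^ m - 1))))"
    by (simp only: card_layer_lists_1[OF assms(1)])
  assume eq: "num_connected ?H = num_connected_L G n"
  show "complete_digraph m (with_proj G) \<or> n \<in> {1, 2}"
  proof (rule ccontr)
    assume *: "\<not> (complete_digraph m (with_proj G) \<or> n \<in> {1, 2})"
    have "parcs G \<noteq> {(x, y). (x, y) \<in> pverts G \<times> pverts G \<and> x \<noteq> y}"
      using * assms(3) pair_graphD_graph by (auto simp: complete_digraph_def)
    \<comment> \<open>All arcs join distinct vertices of \<open>G\<close>, so the arc set can differ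
      from the complete one only by a missing pair.\<close>
    then obtain a b where "a \<in> pverts G" "b \<in> pverts G" "a \<noteq> b" "(a, b) \<notin> parcs G"
      using in_arcsD1 in_arcsD2 no_loops' by fast
    then have "connected_sets_L G n \<noteq> connected_sets ?H"
      using * assms(4) by (intro connected_sets_L_psubset[OF assms(1,2)]) auto
    then show False
      using card_subset_eq[OF fin connected_sets_L_subset] eq
      by (simp add: num_connected_L_def num_connected_def)
  qed
qed

end
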